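(* Consider a $k$-Median instance with $2\le k\le n/3$ in which every customer $j\in W$ has a center $i\in U$ with $c_{ij}=0$. Given any set $C\subseteq U$ of at most $T$ centers and any $\lambda\in\mathbb{R}_{\ge0}\cup\{\infty\}$ such that $\tilde c(\lambda,C)<1$, a set $C'\subseteq U$ of size at most $T+2k$ and cost $c(C')\le\lambda$ can be computed in time $O(m+n\log n)$.
   Context: A $k$-Median instance is a bipartite graph $G=(U,W,E)$ (centers $U$, customers $W$), costs $c_{ij}\ge0$ for $(i,j)\in E$, $c_{ij}=\infty$ for $(i,j)\notin E$, and a positive integer $k$; $n=|W|$, $m=|E|$; the cost of $C\subseteq U$ is $c(C)=\sum_{j\in W}\min_{i\in C}c_{ij}$. $T=\lceil k\ln(n^2/(2k(2k+1)))\rceil$. For $\lambda\in\mathbb{R}_{\ge0}\cup\{\infty\}$ and $C\subseteq U$, the capped cost of customer $j$ is $\tilde c_j(\lambda,C)=\min\big(1/(2k+1),\,(1-2k/n)\min_{i\in C}c_{ij}/\lambda\big)$, where $0/0$ and $\infty/\infty$ are interpreted as $0$ (and the minimum over the empty set is $\infty$), and $\tilde c(\lambda,C)=\sum_{j\in W}\tilde c_j(\lambda,C)$. *)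

theory Defs
  imports Complex_Main "HOL-Library.Extended_Nonnegative_Real"
begin

section \<open>The k-median problem\<close>

record ('u, 'w) kmedian =
  centers :: "'u set"
  customers :: "'w set"
  edges :: "('u \<times> 'w) set"
  cost :: "'u \<Rightarrow> 'w \<Rightarrow> ennreal"
  kpar :: nat

definition kmedian_instance :: "('u, 'w) kmedian \<Rightarrow> bool" where
  "kmedian_instance I \<longleftrightarrow>
     finite (centers I) \<and> finite (customers I) \<and>
     edges I \<subseteq> centers I \<times> customers I \<and>
     (\<forall>(i, j) \<in> edges I. cost I i j < \<infinity>) \<and>
     (\<forall>i \<in> centers I. \<forall>j \<in> customers I. (i, j) \<notin> edges I \<longrightarrow> cost I i j = \<infinity>) \<and>
     0 < kpar I"

definition num_customers :: "('u, 'w) kmedian \<Rightarrow> nat" where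
  "num_customers I = card (customers I)"

definition num_edges :: "('u, 'w) kmedian \<Rightarrow> nat" where
  "num_edges I = card (edges I)"

text \<open>The infimum over the empty set is \<open>\<infinity>\<close> in \<^typ>\<open>ennreal\<close>; over a finite nonempty set it
  is the minimum.\<close>

definition dist_to :: "('u, 'w) kmedian \<Rightarrow> 'u set \<Rightarrow> 'w \<Rightarrow> ennreal" where
  "dist_to I C j = (INF i\<in>C. cost I i j)"

definition set_cost :: "('u, 'w) kmedian \<Rightarrow> 'u set \<Rightarrow> ennreal" where
  "set_cost I C = (\<Sum>j\<in>customers I. dist_to I C j)"

definition T_bound :: "('u, 'w) kmedian \<Rightarrow> int" where
  "T_bound I = (let k = real (kpar I); n = real (num_customers I)
     in \<lceil>k * ln (n\<^sup>2 / (2 * k * (2 * k + 1)))\<rceil>)"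

text \<open>Division in \<^typ>\<open>ennreal\<close> satisfies \<open>0 / 0 = 0\<close> and \<open>\<infinity> / \<infinity> = 0\<close>, whereas
  \<open>x / 0 = \<infinity>\<close> for \<open>x > 0\<close> and \<open>\<infinity> / x = \<infinity>\<close> for \<open>x < \<infinity>\<close>.\<close>

definition capped_cost1 :: "('u, 'w) kmedian \<Rightarrow> ennreal \<Rightarrow> 'u set \<Rightarrow> 'w \<Rightarrow> ennreal" where
  "capped_cost1 I lam C j = (let k = real (kpar I); n = real (num_customers I)
     in min (ennreal (1 / (2 * k + 1))) (ennreal (1 - 2 * k / n) * (dist_to I C j / lam)))"

definition capped_cost :: "('u, 'w) kmedian \<Rightarrow> ennreal \<Rightarrow> 'u set \<Rightarrow> ennreal" where
  "capped_cost I lam C = (\<Sum>j\<in>customers I. capped_cost1 I lam C j)"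


section \<open>A real RAM\<close>

text \<open>Running time is measured on a unit-cost random access machine with a store for natural
  numbers (indices, with addition and truncated subtraction) and a store for real numbers (with
  the field operations and comparison, but no rounding), presented as a while language with named
  scalars and named, unbounded arrays. A program mentions only finitely many names, so the arrays
  can be interleaved in a single linear memory at the price of a constant factor. The only
  constants are natural numbers, so that a program cannot carry information in a real constant.\<close>

type_synonym vname = string

record state =
  nvar :: "vname \<Rightarrow> nat"
  narr :: "vname \<Rightarrow> nat \<Rightarrow> nat"
  rvar :: "vname \<Rightarrow> real"
  rarr :: "vname \<Rightarrow> nat \<Rightarrow> real"

datatype nexp =
    NConst nat
  | NVar vname
  | NArr vname nexp
  | NAdd nexp nexp
  | NSub nexp nexp

datatype rexp =
    OfNat nexp
  | RVar vname
  | RArr vname nexp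
  | RAdd rexp rexp
  | RSub rexp rexp
  | RMul rexp rexp
  | RDiv rexp rexp

datatype bexp =
    NLess nexp nexp
  | RLess rexp rexp
  | Neg bexp
  | Conj bexp bexp

fun nval :: "nexp \<Rightarrow> state \<Rightarrow> nat" where
  "nval (NConst a) s = a"
| "nval (NVar x) s = nvar s x"
| "nval (NArr x e) s = narr s x (nval e s)"
| "nval (NAdd e1 e2) s = nval e1 s + nval e2 s"
| "nval (NSub e1 e2) s = nval e1 s - nval e2 s"

fun rval :: "rexp \<Rightarrow> state \<Rightarrow> real" where
  "rval (OfNat e) s = real (nval e s)"
| "rval (RVar x) s = rvar s x"
| "rval (RArr x e) s = rarr s x (nval e s)"
| "rval (RAdd e1 e2) s = rval e1 s + rval e2 s"
| "rval (RSub e1 e2) s = rval e1 s - rval e2 s"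
| "rval (RMul e1 e2) s = rval e1 s * rval e2 s"
| "rval (RDiv e1 e2) s = rval e1 s / rval e2 s"

fun bval :: "bexp \<Rightarrow> state \<Rightarrow> bool" where
  "bval (NLess e1 e2) s \<longleftrightarrow> nval e1 s < nval e2 s"
| "bval (RLess e1 e2) s \<longleftrightarrow> rval e1 s < rval e2 s"
| "bval (Neg b) s \<longleftrightarrow> \<not> bval b s"
| "bval (Conj b1 b2) s \<longleftrightarrow> bval b1 s \<and> bval b2 s"

datatype com =
    Skip
  | NAssign vname nexp
  | NStore vname nexp nexp
  | RAssign vname rexp
  | RStore vname nexp rexp
  | Seq com com
  | Cond bexp com com
  | While bexp com

text \<open>\<open>exec c s t s'\<close>: started in \<open>s\<close>, the program \<open>c\<close> halts in \<open>s'\<close> after \<open>t\<close> steps. Every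
  assignment and every test counts as one step; the expressions occurring in a fixed program have
  bounded size, so counting their operations separately would change \<open>t\<close> by at most a constant
  factor.\<close>

inductive exec :: "com \<Rightarrow> state \<Rightarrow> nat \<Rightarrow> state \<Rightarrow> bool" where
  Skip: "exec Skip s 1 s"
| NAssign: "exec (NAssign x e) s 1 (s\<lparr>nvar := (nvar s)(x := nval e s)\<rparr>)"
| NStore: "exec (NStore x a e) s 1
    (s\<lparr>narr := (narr s)(x := (narr s x)(nval a s := nval e s))\<rparr>)"
| RAssign: "exec (RAssign x e) s 1 (s\<lparr>rvar := (rvar s)(x := rval e s)\<rparr>)"
| RStore: "exec (RStore x a e) s 1
    (s\<lparr>rarr := (rarr s)(x := (rarr s x)(nval a s := rval e s))\<rparr>)"
| Seq: "exec c1 s t1 s' \<Longrightarrow> exec c2 s' t2 s'' \<Longrightarrow> exec (Seq c1 c2) s (t1 + t2) s''"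
| CondTrue: "bval b s \<Longrightarrow> exec c1 s t s' \<Longrightarrow> exec (Cond b c1 c2) s (1 + t) s'"
| CondFalse: "\<not> bval b s \<Longrightarrow> exec c2 s t s' \<Longrightarrow> exec (Cond b c1 c2) s (1 + t) s'"
| WhileFalse: "\<not> bval b s \<Longrightarrow> exec (While b c) s 1 s"
| WhileTrue: "bval b s \<Longrightarrow> exec c s t1 s' \<Longrightarrow> exec (While b c) s' t2 s'' \<Longrightarrow>
    exec (While b c) s (1 + t1 + t2) s''"

lemma exec_deterministic:
  "exec c s t s' \<Longrightarrow> exec c s u s'' \<Longrightarrow> u = t \<and> s'' = s'"
proof (induction arbitrary: u s'' rule: exec.induct)
  case (Seq c1 s t1 s1 c2 t2 s2)
  from Seq.prems show ?case by cases (use Seq.IH in blast)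
next
  case (CondTrue b s c1 t s1 c2)
  from CondTrue.prems show ?case by cases (use CondTrue.IH CondTrue.hyps in blast)+
next
  case (CondFalse b s c2 t s1 c1)
  from CondFalse.prems show ?case by cases (use CondFalse.IH CondFalse.hyps in blast)+
next
  case (WhileFalse b s c)
  from WhileFalse.prems show ?case by cases (use WhileFalse.hyps in blast)+
next
  case (WhileTrue b s c t1 s1 t2 s2)
  from WhileTrue.prems show ?case by cases (use WhileTrue.IH WhileTrue.hyps in blast)+
qed (erule exec.cases; simp; fail)+


section \<open>Input and output\<close>

text \<open>Centers and customers are presented to the machine by numbers below \<open>|U|\<close> and \<open>|W|\<close>, under
  arbitrary bijective numberings \<open>f\<close> and \<open>g\<close>; the edges and the set \<open>C\<close> are given as lists
  in arbitrary order and without repetitions.\<close>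

definition presentation ::
  "('u, 'w) kmedian \<Rightarrow> 'u set \<Rightarrow> ('u \<Rightarrow> nat) \<Rightarrow> ('w \<Rightarrow> nat) \<Rightarrow> ('u \<times> 'w) list \<Rightarrow> 'u list \<Rightarrow> bool"
  where
  "presentation I C f g es cs \<longleftrightarrow>
     bij_betw f (centers I) {..<card (centers I)} \<and>
     bij_betw g (customers I) {..<card (customers I)} \<and>
     distinct es \<and> set es = edges I \<and>
     distinct cs \<and> set cs = C"

definition array_of :: "'a::zero list \<Rightarrow> nat \<Rightarrow> 'a" where
  "array_of xs a = (if a < length xs then xs ! a else 0)"

text \<open>Note that \<^term>\<open>enn2real \<infinity> = 0\<close>: an infinite \<open>\<lambda>\<close> is signalled by a separate flag. All
  costs in the edge list are finite.\<close>

definition input_state ::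
  "('u, 'w) kmedian \<Rightarrow> ennreal \<Rightarrow> ('u \<Rightarrow> nat) \<Rightarrow> ('w \<Rightarrow> nat) \<Rightarrow> ('u \<times> 'w) list \<Rightarrow> 'u list \<Rightarrow> state"
  where
  "input_state I lam f g es cs =
     \<lparr> nvar = (\<lambda>x. 0)
         (''num_centers'' := card (centers I),
          ''num_customers'' := num_customers I,
          ''num_edges'' := length es,
          ''k'' := kpar I,
          ''C_size'' := length cs,
          ''lambda_infinite'' := (if lam = \<infinity> then 1 else 0)),
       narr = (\<lambda>x a. 0)
         (''edge_center'' := array_of (map (\<lambda>(i, j). f i) es),
          ''edge_customer'' := array_of (map (\<lambda>(i, j). g j) es),
          ''C'' := array_of (map f cs)),
       rvar = (\<lambda>x. 0)(''lambda'' := enn2real lam),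
       rarr = (\<lambda>x a. 0)
         (''edge_cost'' := array_of (map (\<lambda>(i, j). enn2real (cost I i j)) es)) \<rparr>"

definition outputs :: "state \<Rightarrow> ('u \<Rightarrow> nat) \<Rightarrow> 'u set \<Rightarrow> bool" where
  "outputs s f C \<longleftrightarrow>
     (let xs = map (narr s ''out'') [0..<nvar s ''out_size''] in distinct xs \<and> set xs = f ` C)"

end

theory Submission
  imports Defs
begin

text \<open>Let \<open>d j\<close> be the distance of customer \<open>j\<close> to \<open>C\<close>. As each capped customer contributes
  \<open>1 / (2 * k + 1)\<close> to a total below 1, at most \<open>2 * k\<close> customers are capped; a center of cost 0
  is added for each of them. The remaining additions, up to \<open>2 * k\<close> altogether, must remove from
  the total distance of the uncapped customers at least the share that a random choice would remove.
  This needs no sorting: scanning the uncapped customers once and serving a customer whenever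
  its distance is at least the average over the customers not yet scanned derandomises the random
  choice. The customers left then have total distance at most \<open>\<lambda>\<close>, by the factor \<open>1 - 2 * k / n\<close> in
  the capped cost. Everything takes time linear in \<open>m + n + |C|\<close>, and \<open>|C| \<le> T\<close> is
  \<open>O(n log n)\<close>.\<close>

section \<open>Counting loops\<close>

fun loop_free :: "com \<Rightarrow> bool" where
  "loop_free (Seq c1 c2) \<longleftrightarrow> loop_free c1 \<and> loop_free c2"
| "loop_free (Cond b c1 c2) \<longleftrightarrow> loop_free c1 \<and> loop_free c2"
| "loop_free (While b c) \<longleftrightarrow> False"
| "loop_free c \<longleftrightarrow> True"

text \<open>An evaluator meant for loop-free programs only; the \<open>While\<close> clause is a
  dummy that makes the function total. It lets the simplifier compute the effect of a loop
  body.\<close>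

fun run :: "com \<Rightarrow> state \<Rightarrow> state" where
  "run Skip s = s"
| "run (NAssign x e) s = s\<lparr>nvar := (nvar s)(x := nval e s)\<rparr>"
| "run (NStore x a e) s = s\<lparr>narr := (narr s)(x := (narr s x)(nval a s := nval e s))\<rparr>"
| "run (RAssign x e) s = s\<lparr>rvar := (rvar s)(x := rval e s)\<rparr>"
| "run (RStore x a e) s = s\<lparr>rarr := (rarr s)(x := (rarr s x)(nval a s := rval e s))\<rparr>"
| "run (Seq c1 c2) s = run c2 (run c1 s)"
| "run (Cond b c1 c2) s = (if bval b s then run c1 s else run c2 s)"
| "run (While b c) s = s"

text \<open>Only an upper bound: both branches of a conditional are added, so that the bound does
  not depend on the state.\<close>

fun steps :: "com \<Rightarrow> nat" where
  "steps (Seq c1 c2) = steps c1 + steps c2"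
| "steps (Cond b c1 c2) = 1 + steps c1 + steps c2"
| "steps c = 1"

lemma exec_run:
  assumes "loop_free c"
  shows "\<exists>t \<le> steps c. exec c s t (run c s)"
  using assms
proof (induction c arbitrary: s)
  case (Seq c1 c2)
  obtain t1 where t1: "t1 \<le> steps c1" "exec c1 s t1 (run c1 s)"
    using Seq by auto
  obtain t2 where t2: "t2 \<le> steps c2" "exec c2 (run c1 s) t2 (run c2 (run c1 s))"
    using Seq by auto
  have "exec (Seq c1 c2) s (t1 + t2) (run (Seq c1 c2) s)"
    using exec.Seq t1 t2 by simp
  then show ?case using t1 t2 by (intro exI[of _ "t1 + t2"]) simp
next
  case (Cond b c1 c2)
  show ?case
  proof (cases "bval b s")
    case True
    obtain t where "t \<le> steps c1" "exec c1 s t (run c1 s)" using Cond by auto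
    then show ?thesis using True exec.CondTrue[OF True] by (intro exI[of _ "1 + t"]) simp
  next
    case False
    obtain t where "t \<le> steps c2" "exec c2 s t (run c2 s)" using Cond by auto
    then show ?thesis using False exec.CondFalse[OF False] by (intro exI[of _ "1 + t"]) simp
  qed
qed (auto intro!: exI[of _ 1] exec.intros exec.intros[simplified])

text \<open>Indexing the invariant by the counter \<open>a\<close> yields termination, the invariant
  at exit and the time bound from one induction on the number \<open>N - a\<close> of remaining
  rounds.\<close>

lemma exec_while_counting:
  assumes free: "loop_free c"
    and test: "\<And>a s. Inv a s \<Longrightarrow> bval b s \<longleftrightarrow> a < N"
    and step: "\<And>a s. a < N \<Longrightarrow> Inv a s \<Longrightarrow> Inv (Suc a) (run c s)"
    and "Inv a s" "a \<le> N"
  shows "\<exists>t s'. exec (While b c) s t s' \<and> Inv N s' \<and> t \<le> 1 + (N - a) * (1 + steps c)"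
  using assms(4,5)
proof (induction "N - a" arbitrary: a s)
  case 0
  then have "a = N" by simp
  with 0 test show ?case
    by (intro exI[of _ 1] exI[of _ s]) (auto intro: exec.WhileFalse exec.WhileFalse[simplified])
next
  case (Suc x)
  then have "a < N" by simp
  obtain t1 where t1: "t1 \<le> steps c" "exec c s t1 (run c s)"
    using exec_run[OF free] by blast
  obtain t2 s' where t2: "exec (While b c) (run c s) t2 s'" "Inv N s'"
      "t2 \<le> 1 + (N - Suc a) * (1 + steps c)"
    using Suc.hyps(1)[OF _ step[OF \<open>a < N\<close> Suc.prems(1)]] Suc.hyps(2) \<open>a < N\<close> by force
  have "exec (While b c) s (1 + t1 + t2) s'"
    using exec.WhileTrue t1 t2 test Suc.prems \<open>a < N\<close> by blast
  moreover have "N - a = Suc (N - Suc a)" using \<open>a < N\<close> by simp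
  then have "1 + t1 + t2 \<le> 1 + (N - a) * (1 + steps c)" using t1 t2 by simp
  ultimately show ?case using t2 by blast
qed

definition count_loop :: "vname \<Rightarrow> com \<Rightarrow> com" where
  "count_loop y c = Seq (NAssign ''i'' (NConst 0))
     (While (NLess (NVar ''i'') (NVar y)) (Seq c (NAssign ''i'' (NAdd (NVar ''i'') (NConst 1)))))"

lemma exec_count_loop:
  assumes "loop_free c"
    and "\<And>a s. Inv a s \<Longrightarrow> nvar s ''i'' = a \<and> nvar s y = N"
    and "\<And>a s. a < N \<Longrightarrow> Inv a s \<Longrightarrow>
      Inv (Suc a) (run (Seq c (NAssign ''i'' (NAdd (NVar ''i'') (NConst 1)))) s)"
    and "Inv 0 (s\<lparr>nvar := (nvar s)(''i'' := 0)\<rparr>)"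
  shows "\<exists>t s'. exec (count_loop y c) s t s' \<and> Inv N s' \<and> t \<le> 2 + N * (2 + steps c)"
proof -
  let ?c = "Seq c (NAssign ''i'' (NAdd (NVar ''i'') (NConst 1)))"
  let ?b = "NLess (NVar ''i'') (NVar y)"
  let ?s = "s\<lparr>nvar := (nvar s)(''i'' := 0)\<rparr>"
  have "\<exists>t s'. exec (While ?b ?c) ?s t s' \<and> Inv N s' \<and> t \<le> 1 + (N - 0) * (1 + steps ?c)"
    by (rule exec_while_counting[where Inv = Inv]) (use assms in auto)
  then obtain t s' where t: "exec (While ?b ?c) ?s t s'" "Inv N s'" "t \<le> 1 + N * (1 + steps ?c)"
    by auto
  have "exec (NAssign ''i'' (NConst 0)) s 1 ?s"
    using exec.NAssign[of "''i''" "NConst 0" s] by simp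
  from exec.Seq[OF this t(1)] have "exec (count_loop y c) s (1 + t) s'"
    by (simp add: count_loop_def)
  with t show ?thesis by (intro exI[of _ "1 + t"] exI[of _ s']) simp
qed


section \<open>The program\<close>

text \<open>The array \<open>in\<close> holds membership flags, so a center is appended in constant
  time and never twice; \<open>outputs\<close> demands distinct entries.\<close>

definition add_center :: com where
  "add_center =
     Cond (NLess (NConst 0) (NArr ''in'' (NVar ''c''))) Skip
       (Seq (NStore ''out'' (NVar ''out_size'') (NVar ''c''))
       (Seq (NStore ''in'' (NVar ''c'') (NConst 1))
         (NAssign ''out_size'' (NAdd (NVar ''out_size'') (NConst 1)))))"

definition copy_body :: com where
  "copy_body = Seq (NAssign ''c'' (NArr ''C'' (NVar ''i''))) add_center"

text \<open>The flag \<open>has\<close> marks a finite distance, since the machine's reals have no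
  infinite value. With only negation and conjunction available, the last test encodes a disjunction:
  no distance is stored yet, or the new cost is smaller.\<close>

definition scan_body :: com where
  "scan_body =
     Seq (NAssign ''j'' (NArr ''edge_customer'' (NVar ''i'')))
    (Seq (NAssign ''c'' (NArr ''edge_center'' (NVar ''i'')))
    (Seq (Cond (RLess (OfNat (NConst 0)) (RArr ''edge_cost'' (NVar ''i''))) Skip
           (NStore ''zero'' (NVar ''j'') (NVar ''c'')))
         (Cond (Conj (NLess (NConst 0) (NArr ''in'' (NVar ''c'')))
                 (Neg (Conj (NLess (NConst 0) (NArr ''has'' (NVar ''j'')))
                   (Neg (RLess (RArr ''edge_cost'' (NVar ''i'')) (RArr ''d'' (NVar ''j'')))))))
           (Seq (NStore ''has'' (NVar ''j'') (NConst 1))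
                (RStore ''d'' (NVar ''j'') (RArr ''edge_cost'' (NVar ''i''))))
           Skip)))"

text \<open>For a stored distance \<open>d\<close> this is
  \<open>(1 - 2 * k / n) * d / \<lambda> > 1 / (2 * k + 1)\<close>, cleared of denominators so that
  \<lambda> = 0 is covered too.\<close>

definition far_test :: bexp where
  "far_test = Neg (Conj (NLess (NConst 0) (NArr ''has'' (NVar ''i'')))
     (Neg (RLess (RMul (OfNat (NVar ''num_customers'')) (RVar ''lambda''))
       (RMul (RMul (OfNat (NSub (NVar ''num_customers'') (NAdd (NVar ''k'') (NVar ''k''))))
                   (OfNat (NAdd (NAdd (NVar ''k'') (NVar ''k'')) (NConst 1))))
             (RArr ''d'' (NVar ''i''))))))"

text \<open>The counter \<open>r\<close> is the number of additions still allowed. It decreases even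
  if the center is already listed, so it counts customers taken rather than new centers.\<close>

definition take_customer :: com where
  "take_customer = Seq (NAssign ''r'' (NSub (NVar ''r'') (NConst 1)))
     (Seq (NAssign ''c'' (NArr ''zero'' (NVar ''i''))) add_center)"

text \<open>The guard on \<open>r\<close> matters only if \<open>\<lambda> = \<infinity>\<close>: the machine then reads \<open>\<lambda>\<close> as 0, and more than
  \<open>2 * k\<close> customers may pass the test.\<close>

definition far_body :: com where
  "far_body = Cond far_test
     (Seq (NAssign ''q'' (NSub (NVar ''q'') (NConst 1)))
          (Cond (NLess (NConst 0) (NVar ''r'')) take_customer Skip))
     (RAssign ''R'' (RAdd (RVar ''R'') (RArr ''d'' (NVar ''i''))))"

text \<open>Here \<open>q\<close> and \<open>R\<close> are the number and the total distance of the
  customers not yet scanned, far ones excluded. While additions are left, a customer is taken if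
  they suffice for all remaining ones or if its distance is at least the average
  \<open>R / q\<close>.\<close>

definition near_body :: com where
  "near_body = Cond far_test Skip
     (Seq (Cond (Conj (NLess (NConst 0) (NVar ''r''))
                  (Neg (Conj (NLess (NVar ''r'') (NVar ''q''))
                    (RLess (RMul (RArr ''d'' (NVar ''i'')) (OfNat (NVar ''q''))) (RVar ''R'')))))
            take_customer Skip)
     (Seq (NAssign ''q'' (NSub (NVar ''q'') (NConst 1)))
          (RAssign ''R'' (RSub (RVar ''R'') (RArr ''d'' (NVar ''i''))))))"

definition init_counters :: com where
  "init_counters = Seq (NAssign ''r'' (NAdd (NVar ''k'') (NVar ''k'')))
     (Seq (NAssign ''q'' (NVar ''num_customers'')) (RAssign ''R'' (OfNat (NConst 0))))"

definition augment :: com where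
  "augment = Seq (count_loop ''C_size'' copy_body)
     (Seq (count_loop ''num_edges'' scan_body)
     (Seq init_counters
     (Seq (count_loop ''num_customers'' far_body)
          (count_loop ''num_customers'' near_body))))"

lemma loop_free_bodies:
  "loop_free copy_body" "loop_free scan_body" "loop_free init_counters"
  "loop_free far_body" "loop_free near_body"
  by (simp_all add: copy_body_def scan_body_def init_counters_def far_body_def near_body_def
      take_customer_def add_center_def)

lemma steps_bodies:
  "steps copy_body = 6" "steps scan_body = 9" "steps init_counters = 3"
  "steps far_body = 12" "steps near_body = 13"
  by (simp_all add: copy_body_def scan_body_def init_counters_def far_body_def near_body_def
      take_customer_def add_center_def)

text \<open>The representation invariant of the output. It mentions only \<open>out\<close>,
  \<open>out_size\<close> and \<open>in\<close>, hence survives assignments to all other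
  names.\<close>

definition listed :: "state \<Rightarrow> nat set \<Rightarrow> bool" where
  "listed s X \<longleftrightarrow> inj_on (narr s ''out'') {..<nvar s ''out_size''} \<and>
     narr s ''out'' ` {..<nvar s ''out_size''} = X \<and> (\<forall>x. 0 < narr s ''in'' x \<longleftrightarrow> x \<in> X)"

lemma listed_in:
  assumes "listed s X"
  shows "0 < narr s ''in'' x \<longleftrightarrow> x \<in> X" "narr s ''in'' x = 0 \<longleftrightarrow> x \<notin> X"
proof -
  show pos: "0 < narr s ''in'' x \<longleftrightarrow> x \<in> X" using assms by (simp add: listed_def)
  show "narr s ''in'' x = 0 \<longleftrightarrow> x \<notin> X" using pos by linarith
qed

lemma run_add_center [simp]:
  "x \<noteq> ''out_size'' \<Longrightarrow> nvar (run add_center s) x = nvar s x"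
  "x \<noteq> ''out'' \<Longrightarrow> x \<noteq> ''in'' \<Longrightarrow> narr (run add_center s) x = narr s x"
  "rvar (run add_center s) = rvar s"
  "rarr (run add_center s) = rarr s"
  by (auto simp: add_center_def)

lemma listed_add_center:
  assumes "listed s X"
  shows "listed (run add_center s) (insert (nvar s ''c'') X)"
proof (cases "nvar s ''c'' \<in> X")
  case True
  then have "run add_center s = s" using assms by (simp add: add_center_def listed_def)
  with True assms show ?thesis by (simp add: insert_absorb)
next
  case False
  let ?o = "narr s ''out''" and ?k = "nvar s ''out_size''" and ?c = "nvar s ''c''"
  have img: "(?o(?k := ?c)) ` {..<Suc ?k} = insert ?c (?o ` {..<?k})"
    by (auto simp: lessThan_Suc)
  have "inj_on (?o(?k := ?c)) {..<Suc ?k}"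
    using assms False unfolding listed_def inj_on_def by (force simp: less_Suc_eq)
  with img assms False show ?thesis
    by (auto simp: add_center_def listed_def)
qed

lemma run_take_customer [simp]:
  "x \<noteq> ''out_size'' \<Longrightarrow> x \<noteq> ''r'' \<Longrightarrow> x \<noteq> ''c'' \<Longrightarrow> nvar (run take_customer s) x = nvar s x"
  "nvar (run take_customer s) ''r'' = nvar s ''r'' - 1"
  "x \<noteq> ''out'' \<Longrightarrow> x \<noteq> ''in'' \<Longrightarrow> narr (run take_customer s) x = narr s x"
  "rvar (run take_customer s) = rvar s"
  "rarr (run take_customer s) = rarr s"
  by (simp_all add: take_customer_def)

lemma listed_take_customer:
  assumes "listed s X"
  shows "listed (run take_customer s) (insert (narr s ''zero'' (nvar s ''i'')) X)"
proof -
  let ?s = "run (NAssign ''c'' (NArr ''zero'' (NVar ''i'')))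
    (run (NAssign ''r'' (NSub (NVar ''r'') (NConst 1))) s)"
  have "listed ?s X" using assms by (simp add: listed_def)
  from listed_add_center[OF this] show ?thesis by (simp add: take_customer_def)
qed


section \<open>Choosing customers one by one\<close>

text \<open>If \<open>r\<close> of the \<open>q\<close> remaining customers, of total cost \<open>R\<close>, are chosen uniformly at random,
  the expected cost of the others is \<open>(1 - r / q) * R\<close>. Choosing a customer of at least average
  cost, and passing over one of less than average cost, does not increase this expectation.\<close>

lemma expected_rest_choose:
  fixes R a :: real and q r :: nat
  assumes "0 < r" "r \<le> q" "q \<le> r \<or> R \<le> a * real q" "q = 1 \<Longrightarrow> R = a"
  shows "(1 - real (r - 1) / real (q - 1)) * (R - a) \<le> (1 - real r / real q) * R"
\<comment> \<open>For \<open>q = r\<close> both factors are 0, except that for \<open>q = 1\<close>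
  the left one is 1 by the convention \<open>0 / 0 = 0\<close>; there \<open>R = a\<close> makes the
  left side vanish.\<close>
proof (cases "q = r")
  case True
  with assms show ?thesis by (cases "q = 1") auto
next
  case False
  with assms have rq: "r < q" and avg: "R \<le> a * real q" by auto
  then have q: "real (q - 1) = real q - 1" "real (r - 1) = real r - 1" "1 < real q"
    using assms by auto
  have "1 - real (r - 1) / real (q - 1) = (real q - real r) / (real q - 1)"
    using q by (simp add: field_simps)
  moreover have "1 - real r / real q = (real q - real r) / real q"
    using q by (simp add: field_simps)
  \<comment> \<open>Removing a value no smaller than the average does not raise the average of the
    others.\<close>
  moreover have "(R - a) / (real q - 1) \<le> R / real q"
    using q avg by (simp add: field_simps)
  then have "(real q - real r) * ((R - a) / (real q - 1)) \<le> (real q - real r) * (R / real q)"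
    using rq by (intro mult_left_mono) auto
  ultimately show ?thesis by simp
qed

lemma expected_rest_pass:
  fixes R a :: real and q r :: nat
  assumes "r = 0 \<or> r < q \<and> a * real q < R" "q = 1 \<Longrightarrow> R = a"
  shows "a + (1 - real r / real (q - 1)) * (R - a) \<le> (1 - real r / real q) * R"
proof (cases "r = 0")
  case True
  then show ?thesis by simp
next
  case False
  with assms have rq: "r < q" and avg: "a * real q < R" by auto
  then have q: "real (q - 1) = real q - 1" "1 < real q" using False by auto
  \<comment> \<open>Removing a value below the average does not lower the average of the
    others.\<close>
  have "R / real q \<le> (R - a) / (real q - 1)"
    using q avg by (simp add: field_simps)
  then have "real r * (R / real q) \<le> real r * ((R - a) / (real q - 1))"
    by (intro mult_left_mono) auto
  then show ?thesis using q by (simp add: left_diff_distrib)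
qed


section \<open>Correctness of the program\<close>

text \<open>The numbers the machine reads, detached from any instance: \<open>ec\<close>,
  \<open>eu\<close> and \<open>w\<close> give center, customer and cost of each edge,
  \<open>Ca\<close> and \<open>csz\<close> the array for \<open>C\<close> and its length, and
  \<open>l\<close> the value read for \<lambda>.\<close>

locale input_data =
  fixes n m k csz :: nat and l :: real and ec eu Ca :: "nat \<Rightarrow> nat" and w :: "nat \<Rightarrow> real"
begin

definition reads :: "state \<Rightarrow> bool" where
  "reads s \<longleftrightarrow> nvar s ''num_customers'' = n \<and> nvar s ''num_edges'' = m \<and> nvar s ''k'' = k \<and>
     nvar s ''C_size'' = csz \<and> rvar s ''lambda'' = l \<and> narr s ''edge_center'' = ec \<and>
     narr s ''edge_customer'' = eu \<and> narr s ''C'' = Ca \<and> rarr s ''edge_cost'' = w"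

section \<open>Copying \<open>C\<close> and scanning the edges\<close>

lemma exec_copy:
  assumes "reads s" "narr s ''has'' = (\<lambda>_. 0)" "listed s {}"
  shows "\<exists>t s'. exec (count_loop ''C_size'' copy_body) s t s' \<and> t \<le> 2 + 8 * csz \<and>
    reads s' \<and> narr s' ''has'' = (\<lambda>_. 0) \<and> listed s' (Ca ` {..<csz})"
proof -
  define Inv where "Inv a s \<longleftrightarrow> nvar s ''i'' = a \<and> reads s \<and> narr s ''has'' = (\<lambda>_. 0) \<and>
    listed s (Ca ` {..<a})" for a s
  have "\<exists>t s'. exec (count_loop ''C_size'' copy_body) s t s' \<and> Inv csz s' \<and>
      t \<le> 2 + csz * (2 + steps copy_body)"
  proof (rule exec_count_loop)
    fix a s assume "a < csz" and inv: "Inv a s"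
    let ?s = "run (NAssign ''c'' (NArr ''C'' (NVar ''i''))) s"
    have "listed ?s (Ca ` {..<a})" using inv by (simp add: Inv_def listed_def)
    from listed_add_center[OF this] inv
    have "listed (run copy_body s) (Ca ` {..<Suc a})"
      by (simp add: Inv_def reads_def copy_body_def lessThan_Suc)
    then have "listed (run (Seq copy_body (NAssign ''i'' (NAdd (NVar ''i'') (NConst 1)))) s)
        (Ca ` {..<Suc a})" by (simp add: listed_def)
    with inv show "Inv (Suc a) (run (Seq copy_body (NAssign ''i'' (NAdd (NVar ''i'') (NConst 1)))) s)"
      by (simp add: Inv_def reads_def copy_body_def)
  qed (use assms loop_free_bodies in \<open>auto simp: Inv_def reads_def listed_def\<close>)
  then show ?thesis by (auto simp: Inv_def steps_bodies algebra_simps)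
qed

text \<open>The first conjunct makes \<open>d\<close> a lower bound of the costs of the first
  \<open>b\<close> edges out of \<open>X\<close>, the second says that it is attained. Together
  \<open>d\<close> is the minimum, and \<open>has\<close> tells where it is finite.\<close>

definition nearest :: "nat set \<Rightarrow> nat \<Rightarrow> (nat \<Rightarrow> nat) \<Rightarrow> (nat \<Rightarrow> real) \<Rightarrow> bool" where
  "nearest X b has d \<longleftrightarrow>
     (\<forall>e<b. ec e \<in> X \<longrightarrow> 0 < has (eu e) \<and> d (eu e) \<le> w e) \<and>
     (\<forall>j. 0 < has j \<longrightarrow> (\<exists>e<b. eu e = j \<and> ec e \<in> X \<and> d j = w e))"

text \<open>The form \<open>w e \<le> 0\<close> is the negation of the machine's test; edge costs
  being nonnegative, it means cost 0.\<close>

definition zero_centers :: "nat \<Rightarrow> (nat \<Rightarrow> nat) \<Rightarrow> bool" where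
  "zero_centers b zc \<longleftrightarrow>
     (\<forall>e<b. w e \<le> 0 \<longrightarrow> (\<exists>e'<b. eu e' = eu e \<and> w e' \<le> 0 \<and> zc (eu e) = ec e'))"

lemma nearest_keep:
  assumes "nearest X a has d" "\<not> (ec a \<in> X \<and> \<not> (0 < has (eu a) \<and> \<not> w a < d (eu a)))"
  shows "nearest X (Suc a) has d"
  using assms unfolding nearest_def by (auto simp: less_Suc_eq)

lemma nearest_update:
  assumes "nearest X a has d" "ec a \<in> X" "\<not> (0 < has (eu a) \<and> \<not> w a < d (eu a))"
  shows "nearest X (Suc a) (has(eu a := 1)) (d(eu a := w a))"
  unfolding nearest_def
proof (intro conjI allI impI)
  fix e assume "e < Suc a" "ec e \<in> X"
  then show "0 < (has(eu a := 1)) (eu e)" "(d(eu a := w a)) (eu e) \<le> w e"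
    using assms unfolding nearest_def by (auto simp: less_Suc_eq)
next
  fix j assume "0 < (has(eu a := 1)) j"
  then show "\<exists>e<Suc a. eu e = j \<and> ec e \<in> X \<and> (d(eu a := w a)) j = w e"
    using assms unfolding nearest_def by (cases "j = eu a") (auto simp: less_Suc_eq)
qed

lemma zero_centers_Suc:
  assumes "zero_centers a zc"
  shows "zero_centers (Suc a) (if 0 < w a then zc else zc(eu a := ec a))"
  unfolding zero_centers_def
proof (intro allI impI)
  fix e assume "e < Suc a" "w e \<le> 0"
  then show "\<exists>e'<Suc a. eu e' = eu e \<and> w e' \<le> 0 \<and>
      (if 0 < w a then zc else zc(eu a := ec a)) (eu e) = ec e'"
    using assms unfolding zero_centers_def
    by (cases "w a \<le> 0 \<and> eu e = eu a") (auto simp: less_Suc_eq)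
qed

lemma exec_scan:
  assumes "reads s" "narr s ''has'' = (\<lambda>_. 0)" "listed s X"
  shows "\<exists>t s'. exec (count_loop ''num_edges'' scan_body) s t s' \<and> t \<le> 2 + 11 * m \<and>
    reads s' \<and> listed s' X \<and> nearest X m (narr s' ''has'') (rarr s' ''d'') \<and>
    zero_centers m (narr s' ''zero'')"
proof -
  define Inv where "Inv a s \<longleftrightarrow> nvar s ''i'' = a \<and> reads s \<and> listed s X \<and>
    nearest X a (narr s ''has'') (rarr s ''d'') \<and> zero_centers a (narr s ''zero'')" for a s
  have "\<exists>t s'. exec (count_loop ''num_edges'' scan_body) s t s' \<and> Inv m s' \<and>
      t \<le> 2 + m * (2 + steps scan_body)"
  proof (rule exec_count_loop)
    fix a s assume "a < m" and inv: "Inv a s"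
    let ?s = "run (Seq scan_body (NAssign ''i'' (NAdd (NVar ''i'') (NConst 1)))) s"
    let ?upd = "ec a \<in> X \<and> \<not> (0 < narr s ''has'' (eu a) \<and> \<not> w a < rarr s ''d'' (eu a))"
    from inv have "listed s X" by (simp add: Inv_def)
    note in_X = listed_in[OF this]
    have "narr ?s ''zero'' =
        (if 0 < w a then narr s ''zero'' else (narr s ''zero'')(eu a := ec a))"
      using inv by (simp add: Inv_def reads_def scan_body_def)
    then have "zero_centers (Suc a) (narr ?s ''zero'')"
      using zero_centers_Suc inv by (simp add: Inv_def)
    moreover have "narr ?s ''has'' =
          (if ?upd then (narr s ''has'')(eu a := 1) else narr s ''has'')"
        "rarr ?s ''d'' = (if ?upd then (rarr s ''d'')(eu a := w a) else rarr s ''d'')"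
      using inv by (auto simp: Inv_def reads_def scan_body_def in_X)
    then have "nearest X (Suc a) (narr ?s ''has'') (rarr ?s ''d'')"
      using nearest_keep[of X a] nearest_update[of X a] inv by (auto simp: Inv_def)
    moreover have "reads ?s" "listed ?s X" "nvar ?s ''i'' = Suc a"
      using inv by (simp_all add: Inv_def reads_def listed_def scan_body_def)
    ultimately show "Inv (Suc a) ?s" by (simp add: Inv_def)
  qed (use assms loop_free_bodies in
      \<open>auto simp: Inv_def reads_def listed_def nearest_def zero_centers_def\<close>)
  then show ?thesis by (auto simp: Inv_def steps_bodies algebra_simps)
qed

section \<open>The two passes over the customers\<close>

context
  fixes has zc :: "nat \<Rightarrow> nat" and d :: "nat \<Rightarrow> real"
begin

text \<open>Applied to the results of the scan with finite \<lambda>, these are the customers whose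
  scaled distance exceeds the cap. For \<lambda> = \<infinity>, read as \<open>l = 0\<close>, there
  may be more than \<open>2 * k\<close> of them, so later claims are conditional on
  \<open>card far \<le> 2 * k\<close>.\<close>

definition far :: "nat set" where
  "far = {j. j < n \<and> (has j = 0 \<or> real n * l < real (n - 2 * k) * real (2 * k + 1) * d j)}"

definition loaded :: "state \<Rightarrow> bool" where
  "loaded s \<longleftrightarrow> reads s \<and> narr s ''has'' = has \<and> rarr s ''d'' = d \<and> narr s ''zero'' = zc"

lemma finite_far [simp]: "finite far"
  by (simp add: far_def)

lemma far_subset: "far \<subseteq> {..<n}"
  by (auto simp: far_def)

lemma far_test_iff:
  assumes "loaded s" "nvar s ''i'' = a" "a < n"
  shows "bval far_test s \<longleftrightarrow> a \<in> far"
  using assms by (simp add: far_def loaded_def reads_def far_test_def flip: mult_2)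

text \<open>\<open>Q\<close> collects the customers taken. The budget
  \<open>card Q + r \<le> 2 * k\<close> holds in every case and bounds the output size, while
  \<open>Q = far\<close> is claimed only if the far customers fit the budget. If they do not,
  truncated subtraction makes the final \<open>r\<close> zero.\<close>

lemma exec_far:
  assumes "loaded s" "listed s X" "nvar s ''r'' = 2 * k" "nvar s ''q'' = n" "rvar s ''R'' = 0"
  shows "\<exists>t s' Q. exec (count_loop ''num_customers'' far_body) s t s' \<and> t \<le> 2 + 14 * n \<and>
    loaded s' \<and> listed s' (X \<union> zc ` Q) \<and> Q \<subseteq> far \<and> card Q + nvar s' ''r'' \<le> 2 * k \<and>
    (card far \<le> 2 * k \<longrightarrow> Q = far) \<and> nvar s' ''r'' = 2 * k - card far \<and>
    nvar s' ''q'' = n - card far \<and> rvar s' ''R'' = sum d ({..<n} - far)"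
proof -
  define Inv where "Inv a s \<longleftrightarrow> nvar s ''i'' = a \<and> loaded s \<and>
    nvar s ''r'' = 2 * k - card (far \<inter> {..<a}) \<and> nvar s ''q'' = n - card (far \<inter> {..<a}) \<and>
    rvar s ''R'' = sum d ({..<a} - far) \<and>
    (\<exists>Q. listed s (X \<union> zc ` Q) \<and> Q \<subseteq> far \<inter> {..<a} \<and> card Q + nvar s ''r'' \<le> 2 * k \<and>
      (card far \<le> 2 * k \<longrightarrow> Q = far \<inter> {..<a}))" for a s
  have "\<exists>t s'. exec (count_loop ''num_customers'' far_body) s t s' \<and> Inv n s' \<and>
      t \<le> 2 + n * (2 + steps far_body)"
  proof (rule exec_count_loop)
    fix a s assume "a < n" and inv: "Inv a s"
    let ?s = "run (Seq far_body (NAssign ''i'' (NAdd (NVar ''i'') (NConst 1)))) s"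
    from inv obtain Q where Q: "listed s (X \<union> zc ` Q)" "Q \<subseteq> far \<inter> {..<a}"
        "card Q + nvar s ''r'' \<le> 2 * k" "card far \<le> 2 * k \<longrightarrow> Q = far \<inter> {..<a}"
      by (auto simp: Inv_def)
    have test: "bval far_test s \<longleftrightarrow> a \<in> far"
      using far_test_iff inv \<open>a < n\<close> by (simp add: Inv_def)
    show "Inv (Suc a) ?s"
    proof (cases "a \<in> far")
      case False
      then have "far \<inter> {..<Suc a} = far \<inter> {..<a}" "{..<Suc a} - far = insert a ({..<a} - far)"
        by (auto simp: less_Suc_eq)
      moreover have "listed ?s (X \<union> zc ` Q)"
        using Q False test by (simp add: far_body_def listed_def)
      ultimately show ?thesis using inv Q False test
        by (auto simp: Inv_def far_body_def loaded_def reads_def)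
    next
      case True
      then have far_Suc: "far \<inter> {..<Suc a} = insert a (far \<inter> {..<a})"
        and diff: "{..<Suc a} - far = {..<a} - far"
        by (auto simp: less_Suc_eq)
      have card_Suc: "card (far \<inter> {..<Suc a}) = Suc (card (far \<inter> {..<a}))"
        unfolding far_Suc by (subst card_insert_disjoint) auto
      have le: "card (far \<inter> {..<Suc a}) \<le> card far"
        by (intro card_mono) auto
      show ?thesis
      proof (cases "0 < nvar s ''r''")
        case r: True
        let ?s1 = "run (NAssign ''q'' (NSub (NVar ''q'') (NConst 1))) s"
        have "listed ?s1 (X \<union> zc ` Q)" using Q(1) by (simp add: listed_def)
        from listed_take_customer[OF this] inv
        have "listed (run take_customer ?s1) (X \<union> zc ` insert a Q)"
          by (simp add: Inv_def loaded_def)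
        then have "listed ?s (X \<union> zc ` insert a Q)"
          using True test r by (simp add: far_body_def listed_def)
        moreover have "finite Q" "a \<notin> Q" using Q(2) by (auto intro: finite_subset)
        then have "card (insert a Q) + nvar ?s ''r'' \<le> 2 * k"
          using True test r Q(3) by (simp add: far_body_def)
        moreover have "insert a Q \<subseteq> far \<inter> {..<Suc a}"
            "card far \<le> 2 * k \<longrightarrow> insert a Q = far \<inter> {..<Suc a}"
          using Q True unfolding far_Suc by auto
        ultimately have "\<exists>Q. listed ?s (X \<union> zc ` Q) \<and> Q \<subseteq> far \<inter> {..<Suc a} \<and>
            card Q + nvar ?s ''r'' \<le> 2 * k \<and> (card far \<le> 2 * k \<longrightarrow> Q = far \<inter> {..<Suc a})"
          by blast
        moreover have "nvar ?s ''i'' = Suc a" "loaded ?s"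
            "nvar ?s ''r'' = 2 * k - card (far \<inter> {..<Suc a})"
            "nvar ?s ''q'' = n - card (far \<inter> {..<Suc a})"
            "rvar ?s ''R'' = sum d ({..<Suc a} - far)"
          using inv True test r unfolding card_Suc diff
          by (simp_all add: Inv_def far_body_def loaded_def reads_def)
        ultimately show ?thesis unfolding Inv_def by blast
      next
        case r: False
        then have "listed ?s (X \<union> zc ` Q)"
          using Q True test by (simp add: far_body_def listed_def)
        moreover have "Q \<subseteq> far \<inter> {..<Suc a}" using Q by (auto simp: far_Suc)
        \<comment> \<open>An exhausted budget means that at least \<open>2 * k\<close> far customers
          precede \<open>a\<close>; with \<open>a\<close> itself there are too many, and the
          conditional claim is vacuous.\<close>
        moreover have "\<not> card far \<le> 2 * k"
          using r inv le unfolding card_Suc by (simp add: Inv_def)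
        moreover have "card Q + nvar ?s ''r'' \<le> 2 * k"
          using Q True test r by (simp add: far_body_def)
        ultimately have "\<exists>Q. listed ?s (X \<union> zc ` Q) \<and> Q \<subseteq> far \<inter> {..<Suc a} \<and>
            card Q + nvar ?s ''r'' \<le> 2 * k \<and> (card far \<le> 2 * k \<longrightarrow> Q = far \<inter> {..<Suc a})"
          by blast
        moreover have "nvar ?s ''i'' = Suc a" "loaded ?s"
            "nvar ?s ''r'' = 2 * k - card (far \<inter> {..<Suc a})"
            "nvar ?s ''q'' = n - card (far \<inter> {..<Suc a})"
            "rvar ?s ''R'' = sum d ({..<Suc a} - far)"
          using inv True test r unfolding card_Suc diff
          by (simp_all add: Inv_def far_body_def loaded_def reads_def)
        ultimately show ?thesis unfolding Inv_def by blast
      qed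
    qed
  next
    let ?s = "s\<lparr>nvar := (nvar s)(''i'' := 0)\<rparr>"
    have "listed ?s (X \<union> zc ` {})" using assms by (simp add: listed_def)
    then show "Inv 0 ?s"
      using assms by (auto simp: Inv_def loaded_def reads_def intro!: exI[of _ "{}"])
  qed (use loop_free_bodies in \<open>auto simp: Inv_def loaded_def reads_def\<close>)
  then obtain t s' where t: "exec (count_loop ''num_customers'' far_body) s t s'"
      "t \<le> 2 + 14 * n" and inv: "Inv n s'"
    by (auto simp: steps_bodies mult.commute)
  have "far \<inter> {..<n} = far" using far_subset by auto
  with inv obtain Q where "listed s' (X \<union> zc ` Q)" "Q \<subseteq> far" "card Q + nvar s' ''r'' \<le> 2 * k"
      "card far \<le> 2 * k \<longrightarrow> Q = far"
    by (auto simp: Inv_def)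
  with inv t \<open>far \<inter> {..<n} = far\<close> show ?thesis
    by (intro exI[of _ t] exI[of _ s'] exI[of _ Q]) (simp add: Inv_def)
qed

text \<open>The potential is the distance of the scanned customers outside \<open>Q\<close> plus the
  expected rest \<open>(1 - r / q) * R\<close>. By the two averaging lemmas no round increases it
  while the far customers fit the budget.\<close>

lemma exec_near:
  assumes "loaded s" "listed s (X \<union> zc ` Q)" "Q \<subseteq> far" "card Q + nvar s ''r'' \<le> 2 * k"
    and "card far \<le> 2 * k \<longrightarrow> Q = far" "nvar s ''r'' = 2 * k - card far"
    and "nvar s ''q'' = n - card far" "rvar s ''R'' = sum d ({..<n} - far)" "2 * k < n"
  shows "\<exists>t s' Q. exec (count_loop ''num_customers'' near_body) s t s' \<and> t \<le> 2 + 15 * n \<and>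
    listed s' (X \<union> zc ` Q) \<and> Q \<subseteq> {..<n} \<and> card Q \<le> 2 * k \<and>
    (card far \<le> 2 * k \<longrightarrow> far \<subseteq> Q \<and>
      sum d ({..<n} - Q) \<le> real (n - 2 * k) / real (n - card far) * sum d ({..<n} - far))"
proof -
  \<comment> \<open>The initial potential: with \<open>r = 2 * k - card far\<close> and
    \<open>q = n - card far\<close>, the factor \<open>1 - r / q\<close> equals
    \<open>(n - 2 * k) / (n - card far)\<close>.\<close>
  define B where "B = real (n - 2 * k) / real (n - card far) * sum d ({..<n} - far)"
  define near where "near a = {a..<n} - far" for a
  define Inv where "Inv a s \<longleftrightarrow> nvar s ''i'' = a \<and> loaded s \<and>
    (\<exists>Q. listed s (X \<union> zc ` Q) \<and> Q \<subseteq> far \<union> {..<a} \<and> card Q + nvar s ''r'' \<le> 2 * k \<and>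
      (card far \<le> 2 * k \<longrightarrow> far \<subseteq> Q \<and> nvar s ''q'' = card (near a) \<and> rvar s ''R'' = sum d (near a) \<and>
        nvar s ''r'' \<le> nvar s ''q'' \<and>
        sum d ({..<a} - Q) + (1 - real (nvar s ''r'') / real (nvar s ''q'')) * rvar s ''R'' \<le> B))"
    for a s
  have "\<exists>t s'. exec (count_loop ''num_customers'' near_body) s t s' \<and> Inv n s' \<and>
      t \<le> 2 + n * (2 + steps near_body)"
  proof (rule exec_count_loop)
    fix a s assume "a < n" and inv: "Inv a s"
    let ?s = "run (Seq near_body (NAssign ''i'' (NAdd (NVar ''i'') (NConst 1)))) s"
    let ?r = "nvar s ''r''" and ?q = "nvar s ''q''" and ?R = "rvar s ''R''"
    from inv obtain Q where Q: "listed s (X \<union> zc ` Q)" "Q \<subseteq> far \<union> {..<a}"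
        "card Q + ?r \<le> 2 * k"
      and ok: "card far \<le> 2 * k \<Longrightarrow> far \<subseteq> Q \<and> ?q = card (near a) \<and> ?R = sum d (near a) \<and>
        ?r \<le> ?q \<and> sum d ({..<a} - Q) + (1 - real ?r / real ?q) * ?R \<le> B"
      unfolding Inv_def by blast
    have test: "bval far_test s \<longleftrightarrow> a \<in> far"
      using far_test_iff inv \<open>a < n\<close> by (simp add: Inv_def)
    have frame: "nvar ?s ''i'' = Suc a" "loaded ?s"
      using inv by (auto simp: Inv_def near_body_def loaded_def reads_def)
    show "Inv (Suc a) ?s"
    proof (cases "a \<in> far")
      case True
      then have same: "listed ?s (X \<union> zc ` Q)" "nvar ?s ''r'' = ?r" "nvar ?s ''q'' = ?q"
          "rvar ?s ''R'' = ?R"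
        using Q test by (simp_all add: near_body_def listed_def)
      have near_Suc: "near (Suc a) = near a"
        using True unfolding near_def by (auto simp: Suc_le_eq order_less_le)
      have rest: "{..<Suc a} - Q = {..<a} - Q" if "far \<subseteq> Q"
        using True that by (auto simp: less_Suc_eq)
      have "Q \<subseteq> far \<union> {..<Suc a}" using Q(2) by auto
      then show ?thesis unfolding Inv_def same near_Suc
        using frame same(1) Q(3) ok rest by (intro conjI exI[of _ Q]) auto
    next
      case False
      have ins: "near a = insert a (near (Suc a))" "a \<notin> near (Suc a)" "finite (near (Suc a))"
        using False \<open>a < n\<close> by (auto simp: near_def)
      have d_a: "rarr s ''d'' (nvar s ''i'') = d a" using inv by (simp add: Inv_def loaded_def)
      have upd: "nvar ?s ''q'' = ?q - 1" "rvar ?s ''R'' = ?R - d a"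
        using False test d_a by (auto simp: near_body_def)
      have aQ: "a \<notin> Q" using Q(2) False by auto
      have finQ: "finite Q" using Q(2) by (auto intro: finite_subset)
      have counts: "?q - 1 = card (near (Suc a)) \<and> ?R - d a = sum d (near (Suc a)) \<and> 0 < ?q \<and>
          (?q = 1 \<longrightarrow> ?R = d a)" if "card far \<le> 2 * k"
        using ok[OF that] ins by auto
      let ?choose = "0 < ?r \<and> \<not> (?r < ?q \<and> d a * real ?q < ?R)"
      show ?thesis
      proof (cases ?choose)
        case choose: True
        have r: "nvar ?s ''r'' = ?r - 1"
          using False test d_a choose by (simp add: near_body_def)
        have "listed (run take_customer s) (X \<union> zc ` insert a Q)"
          using listed_take_customer[OF Q(1)] inv by (simp add: Inv_def loaded_def)
        then have "listed ?s (X \<union> zc ` insert a Q)"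
          using False test d_a choose by (simp add: near_body_def listed_def)
        moreover have "insert a Q \<subseteq> far \<union> {..<Suc a}" using Q(2) by auto
        moreover have "card (insert a Q) + (?r - 1) \<le> 2 * k"
          using Q(3) aQ finQ choose by simp
        moreover have "sum d ({..<Suc a} - insert a Q) +
            (1 - real (?r - 1) / real (?q - 1)) * (?R - d a) \<le> B" if "card far \<le> 2 * k"
        proof -
          have "(1 - real (?r - 1) / real (?q - 1)) * (?R - d a) \<le> (1 - real ?r / real ?q) * ?R"
            using choose ok[OF that] counts[OF that] by (intro expected_rest_choose) auto
          moreover have "{..<Suc a} - insert a Q = {..<a} - Q" by (auto simp: less_Suc_eq)
          ultimately show ?thesis using ok[OF that] by auto
        qed
        ultimately show ?thesis unfolding Inv_def upd r
          using frame ok counts by (intro conjI exI[of _ "insert a Q"]) auto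
      next
        case pass: False
        have r: "nvar ?s ''r'' = ?r"
          using False test d_a pass by (auto simp: near_body_def)
        have "listed ?s (X \<union> zc ` Q)"
          using False test d_a pass Q(1) by (auto simp: near_body_def listed_def)
        moreover have "Q \<subseteq> far \<union> {..<Suc a}" using Q(2) by auto
        moreover have "sum d ({..<Suc a} - Q) +
            (1 - real ?r / real (?q - 1)) * (?R - d a) \<le> B" if "card far \<le> 2 * k"
        proof -
          have "d a + (1 - real ?r / real (?q - 1)) * (?R - d a) \<le> (1 - real ?r / real ?q) * ?R"
            using pass counts[OF that] by (intro expected_rest_pass) auto
          moreover have "{..<Suc a} - Q = insert a ({..<a} - Q)"
            using aQ by (auto simp: less_Suc_eq)
          then have "sum d ({..<Suc a} - Q) = d a + sum d ({..<a} - Q)" by simp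
          ultimately show ?thesis using ok[OF that] by auto
        qed
        moreover have "?r \<le> ?q - 1" if "card far \<le> 2 * k"
          using pass counts[OF that] by auto
        ultimately show ?thesis unfolding Inv_def upd r
          using frame ok counts Q(3) by (intro conjI exI[of _ Q]) auto
      qed
    qed
  next
    let ?s = "s\<lparr>nvar := (nvar s)(''i'' := 0)\<rparr>"
    have near_0: "near 0 = {..<n} - far" by (auto simp: near_def)
    have card_near: "card (near 0) = n - card far"
      unfolding near_0 using far_subset by (simp add: card_Diff_subset)
    have "listed ?s (X \<union> zc ` Q)" using assms by (simp add: listed_def)
    moreover have "(1 - real (2 * k - card far) / real (n - card far)) * sum d ({..<n} - far) = B"
      if "card far \<le> 2 * k"
      using that \<open>2 * k < n\<close> by (simp add: B_def of_nat_diff field_simps)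
    ultimately show "Inv 0 ?s" unfolding Inv_def
      using assms card_near near_0 
      by (intro conjI exI[of _ Q]) (auto simp: loaded_def reads_def)
  qed (use loop_free_bodies in \<open>auto simp: Inv_def loaded_def reads_def\<close>)
  then obtain t s' where t: "exec (count_loop ''num_customers'' near_body) s t s'"
      "t \<le> 2 + 15 * n" and inv: "Inv n s'"
    by (auto simp: steps_bodies mult.commute)
  from inv obtain Q where Q: "listed s' (X \<union> zc ` Q)" "Q \<subseteq> far \<union> {..<n}"
      "card Q + nvar s' ''r'' \<le> 2 * k"
    and ok: "card far \<le> 2 * k \<Longrightarrow> far \<subseteq> Q \<and> rvar s' ''R'' = sum d (near n) \<and>
        sum d ({..<n} - Q) + (1 - real (nvar s' ''r'') / real (nvar s' ''q'')) * rvar s' ''R'' \<le> B"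
    unfolding Inv_def by blast
  have "Q \<subseteq> {..<n}" using Q(2) far_subset by auto
  \<comment> \<open>Now \<open>R = 0\<close>, so only the actual distances remain in the
    potential.\<close>
  moreover have "near n = {}" by (simp add: near_def)
  ultimately show ?thesis using t Q ok unfolding B_def
    by (intro exI[of _ t] exI[of _ s'] exI[of _ Q]) auto
qed

end

section \<open>The five phases in sequence\<close>

lemma exec_augment:
  assumes "reads s" "narr s ''has'' = (\<lambda>_. 0)" "listed s {}" "2 * k < n"
  shows "\<exists>t s' has zc d Q. exec augment s t s' \<and> t \<le> 11 + 8 * csz + 11 * m + 29 * n \<and>
    nearest (Ca ` {..<csz}) m has d \<and> zero_centers m zc \<and>
    listed s' (Ca ` {..<csz} \<union> zc ` Q) \<and> Q \<subseteq> {..<n} \<and> card Q \<le> 2 * k \<and>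
    (card (far has d) \<le> 2 * k \<longrightarrow> far has d \<subseteq> Q \<and> sum d ({..<n} - Q) \<le>
      real (n - 2 * k) / real (n - card (far has d)) * sum d ({..<n} - far has d))"
proof -
  obtain t1 s1 where 1: "exec (count_loop ''C_size'' copy_body) s t1 s1" "t1 \<le> 2 + 8 * csz"
      "reads s1" "narr s1 ''has'' = (\<lambda>_. 0)" "listed s1 (Ca ` {..<csz})"
    using exec_copy assms by blast
  obtain t2 s2 where 2: "exec (count_loop ''num_edges'' scan_body) s1 t2 s2" "t2 \<le> 2 + 11 * m"
      "reads s2" "listed s2 (Ca ` {..<csz})"
      "nearest (Ca ` {..<csz}) m (narr s2 ''has'') (rarr s2 ''d'')"
      "zero_centers m (narr s2 ''zero'')"
    using exec_scan 1 by blast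
  define has where "has = narr s2 ''has''"
  define zc where "zc = narr s2 ''zero''"
  define d where "d = rarr s2 ''d''"
  define s3 where "s3 = run init_counters s2"
  obtain t3 where 3: "exec init_counters s2 t3 s3" "t3 \<le> 3"
    using exec_run[of init_counters s2] loop_free_bodies steps_bodies by (auto simp: s3_def)
  have s3: "loaded has zc d s3" "listed s3 (Ca ` {..<csz})" "nvar s3 ''r'' = 2 * k"
      "nvar s3 ''q'' = n" "rvar s3 ''R'' = 0"
    using 2(3,4) by (simp_all add: s3_def init_counters_def loaded_def reads_def listed_def
        has_def zc_def d_def)
  obtain t4 s4 Q4 where 4: "exec (count_loop ''num_customers'' far_body) s3 t4 s4"
      "t4 \<le> 2 + 14 * n"
    and s4: "loaded has zc d s4" "listed s4 (Ca ` {..<csz} \<union> zc ` Q4)" "Q4 \<subseteq> far has d"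
      "card Q4 + nvar s4 ''r'' \<le> 2 * k" "card (far has d) \<le> 2 * k \<longrightarrow> Q4 = far has d"
      "nvar s4 ''r'' = 2 * k - card (far has d)" "nvar s4 ''q'' = n - card (far has d)"
      "rvar s4 ''R'' = sum d ({..<n} - far has d)"
    using exec_far[OF s3] by blast
  obtain t5 s5 Q where 5: "exec (count_loop ''num_customers'' near_body) s4 t5 s5"
      "t5 \<le> 2 + 15 * n"
    and s5: "listed s5 (Ca ` {..<csz} \<union> zc ` Q)" "Q \<subseteq> {..<n}" "card Q \<le> 2 * k"
      "card (far has d) \<le> 2 * k \<longrightarrow> far has d \<subseteq> Q \<and> sum d ({..<n} - Q) \<le>
        real (n - 2 * k) / real (n - card (far has d)) * sum d ({..<n} - far has d)"
    using exec_near[OF s4 \<open>2 * k < n\<close>] by blast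
  have "exec augment s (t1 + (t2 + (t3 + (t4 + t5)))) s5"
    unfolding augment_def by (rule exec.Seq[OF 1(1) exec.Seq[OF 2(1) exec.Seq[OF 3(1) exec.Seq[OF 4(1) 5(1)]]]])
  moreover have "t1 + (t2 + (t3 + (t4 + t5))) \<le> 11 + 8 * csz + 11 * m + 29 * n"
    using 1(2) 2(2) 3(2) 4(2) 5(2) by simp
  moreover have "nearest (Ca ` {..<csz}) m has d" "zero_centers m zc"
    using 2(5,6) by (simp_all add: has_def d_def zc_def)
  ultimately show ?thesis using s5 by blast
qed

end


section \<open>From the capped cost to the cost\<close>

text \<open>The capped cost splits into \<open>card F / (2 * k + 1)\<close> from the capped
  customers and the scaled distances of the others. Dropping the second summand from the bound by 1
  gives the first claim, keeping it gives the second. Distances enter as the machine holds them: a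
  flag \<open>h\<close> for finiteness and a real value \<open>D\<close>.\<close>

lemma capped_cost_bounds:
  fixes I :: "('u, 'w) kmedian" and D :: "'w \<Rightarrow> real"
  defines "n \<equiv> real (num_customers I)" and "k \<equiv> real (kpar I)"
  assumes fin: "finite (customers I)" and kn: "2 * k < n" and l: "0 \<le> l"
    and capped: "capped_cost I (ennreal l) C < 1"
    and dist: "\<And>j. j \<in> customers I \<Longrightarrow> dist_to I C j = (if h j then ennreal (D j) else \<infinity>)"
    and D: "\<And>j. j \<in> customers I \<Longrightarrow> h j \<Longrightarrow> 0 \<le> D j"
  defines "F \<equiv> {j \<in> customers I. \<not> h j \<or> n * l < (n - 2 * k) * (2 * k + 1) * D j}"
  shows "card F \<le> 2 * kpar I"
    and "(n - 2 * k) * sum D (customers I - F) \<le> n * l * (1 - real (card F) / (2 * k + 1))"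
proof -
  define c where "c = 1 - 2 * k / n"
  \<comment> \<open>The capped cost as a real number. For \<open>l = 0\<close> the real quotient is
    0, in agreement with \<open>0 / 0 = 0\<close>, because customers outside \<open>F\<close> then
    have distance 0.\<close>
  define x where "x j = (if j \<in> F then 1 / (2 * k + 1) else c * (D j / l))" for j
  have k: "0 \<le> k" by (simp add: k_def)
  have n: "0 < n" using kn k by linarith
  have c: "0 < c" "n - 2 * k = n * c" using kn n by (simp_all add: c_def field_simps)
  have capped1: "capped_cost1 I (ennreal l) C j = ennreal (x j) \<and> 0 \<le> x j"
    if j: "j \<in> customers I" for j
  proof (cases "j \<in> F")
    case True
    have "ennreal (1 / (2 * k + 1)) \<le> ennreal c * (dist_to I C j / ennreal l)"
    proof (cases "h j")
      case False
      then have "dist_to I C j / ennreal l = \<infinity>"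
        using dist[OF j] by (simp add: ennreal_top_divide)
      then show ?thesis using c by (simp add: ennreal_mult_top)
    next
      case h: True
      then have far: "n * l < (n - 2 * k) * (2 * k + 1) * D j"
        using True by (simp add: F_def)
      show ?thesis
      proof (cases "l = 0")
        case True
        \<comment> \<open>For \<lambda> = 0 a positive distance has an infinite quotient, which is
          above the cap.\<close>
        with far have "D j \<noteq> 0" by auto
        with D[OF j h] have "0 < D j" by simp
        then show ?thesis using dist[OF j] h True c
          by (simp add: ennreal_mult_top divide_ennreal_def)
      next
        case False
        with l have "0 < l" by simp
        have "n * l < n * (c * (2 * k + 1) * D j)" using far c(2) by (simp add: mult_ac)
        then have "l < c * (2 * k + 1) * D j" using n by simp
        then have "1 / (2 * k + 1) \<le> c * (D j / l)" using \<open>0 < l\<close> k by (simp add: field_simps)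
        then show ?thesis using dist[OF j] h D[OF j h] \<open>0 < l\<close> c
          by (simp add: divide_ennreal ennreal_mult[symmetric])
      qed
    qed
    then show ?thesis using True k
      by (simp add: capped_cost1_def x_def c_def n_def k_def min_def)
  next
    case False
    then have h: "h j" and near: "(n - 2 * k) * (2 * k + 1) * D j \<le> n * l"
      using j by (auto simp: F_def)
    have "n * (c * (2 * k + 1) * D j) \<le> n * l" using near c(2) by (simp add: mult_ac)
    then have le: "c * (2 * k + 1) * D j \<le> l" using n by simp
    have "ennreal c * (dist_to I C j / ennreal l) = ennreal (c * (D j / l)) \<and> c * (D j / l) \<le> 1 / (2 * k + 1)"
    proof (cases "l = 0")
      case True
      with le c k have "D j \<le> 0" by (auto simp: mult_le_0_iff)
      then show ?thesis using dist[OF j] h True k D[OF j h] by simp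
    next
      case False
      with l have "0 < l" by simp
      then show ?thesis using dist[OF j] h D[OF j h] c le k
        by (simp add: divide_ennreal ennreal_mult[symmetric] field_simps)
    qed
    moreover have "0 \<le> c * (D j / l)" using c D[OF j h] l by simp
    ultimately show ?thesis using False k unfolding capped_cost1_def Let_def
      by (simp add: x_def c_def n_def k_def min_absorb2 ennreal_leI)
  qed
  have "capped_cost I (ennreal l) C = ennreal (sum x (customers I))"
    unfolding capped_cost_def using capped1 by (simp add: sum_ennreal)
  with capped have lt: "sum x (customers I) < 1"
    by (metis ennreal_1 ennreal_less_iff capped1 sum_nonneg)
  have F: "F \<subseteq> customers I" by (auto simp: F_def)
  have "sum x F = real (card F) / (2 * k + 1)" by (simp add: x_def)
  moreover have "sum x (customers I - F) = c * (sum D (customers I - F) / l)"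
    by (simp add: x_def sum_distrib_left sum_divide_distrib)
  ultimately have split: "sum x (customers I) = c * (sum D (customers I - F) / l) + real (card F) / (2 * k + 1)"
    using sum.subset_diff[OF F fin, of x] by simp
  have pos: "0 \<le> sum x (customers I - F)" using capped1 by (intro sum_nonneg) auto
  have "sum x F < 1" using sum.subset_diff[OF F fin, of x] lt pos by simp
  then have "real (card F) / (2 * k + 1) < 1" by (simp add: x_def)
  then have "real (card F) < 2 * k + 1" using k by (simp add: divide_simps)
  \<comment> \<open>By integrality: the cap \<open>1 / (2 * k + 1)\<close> leaves room for at most
    \<open>2 * k\<close> capped customers in a total below 1.\<close>
  then show "card F \<le> 2 * kpar I" by (simp add: k_def)
  show "(n - 2 * k) * sum D (customers I - F) \<le> n * l * (1 - real (card F) / (2 * k + 1))"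
  proof (cases "l = 0")
    case True
    have "D j \<le> 0" if "j \<in> customers I - F" for j
    proof -
      have "(n - 2 * k) * (2 * k + 1) * D j \<le> 0" using that True by (auto simp: F_def)
      then show ?thesis using kn k by (auto simp: mult_le_0_iff)
    qed
    then have "sum D (customers I - F) \<le> 0" by (intro sum_nonpos) auto
    with True kn show ?thesis by (simp add: mult_le_0_iff)
  next
    case False
    with l have "0 < l" by simp
    have "c * (sum D (customers I - F) / l) \<le> 1 - real (card F) / (2 * k + 1)"
      using split lt by linarith
    then have "n * l * (c * (sum D (customers I - F) / l)) \<le> n * l * (1 - real (card F) / (2 * k + 1))"
      using \<open>0 < l\<close> n by (intro mult_left_mono) auto
    then show ?thesis using c(2) \<open>0 < l\<close> by (simp add: mult_ac)
  qed
qed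

text \<open>As \<open>2 * k + 1 \<le> n\<close>, the share \<open>p / (2 * k + 1)\<close> is at
  least \<open>p / n\<close>, and \<open>n * l * (1 - p / n)\<close> is \<open>l * (n - p)\<close>.
  With \<open>p\<close> the number of capped customers, this brings the expected rest down to
  \<lambda>.\<close>

lemma discount_le:
  fixes l n k p :: real
  assumes "0 \<le> l" "0 \<le> k" "2 * k + 1 \<le> n" "0 \<le> p" "p \<le> 2 * k"
    and "(n - 2 * k) * R \<le> n * l * (1 - p / (2 * k + 1))"
  shows "(n - 2 * k) / (n - p) * R \<le> l"
proof -
  have pos: "0 < n - p" "0 < n" using assms by linarith+
  have "p / n \<le> p / (2 * k + 1)" using assms by (intro divide_left_mono) auto
  then have "n * l * (1 - p / (2 * k + 1)) \<le> n * l * (1 - p / n)"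
    using assms pos by (intro mult_left_mono) auto
  also have "\<dots> = l * (n - p)" using pos by (simp add: field_simps)
  finally have "(n - 2 * k) * R \<le> l * (n - p)" using assms by linarith
  then show ?thesis using pos by (simp add: field_simps)
qed

text \<open>Since \<open>2 * k * (2 * k + 1) \<ge> 1\<close> and \<open>k \<le> n / 3\<close>, the
  list \<open>C\<close> has fewer than \<open>2 / 3 * (n * ln n) + 1\<close> entries, the 1 coming
  from the ceiling. Moreover \<open>n \<ge> 6\<close> gives \<open>ln n \<ge> 1\<close>, so
  \<open>8 * 2 / 3 + 29 < 35\<close> leaves room for the additive \<open>11 + 8\<close>.\<close>

lemma steps_le:
  fixes I :: "('u, 'w) kmedian" and csz m :: nat
  defines "n \<equiv> num_customers I" and "k \<equiv> kpar I"
  assumes k: "2 \<le> k" "real k \<le> real n / 3" and csz: "int csz \<le> T_bound I"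
  shows "11 + 8 * real csz + 11 * real m + 29 * real n \<le> 40 * (real m + real n * ln (real n))"
proof -
  have n: "6 \<le> real n" using k by linarith
  have "exp 1 \<le> real n" using exp_le n by linarith
  then have ln: "1 \<le> ln (real n)" using n by (subst ln_ge_iff) auto
  let ?x = "(real n)\<^sup>2 / (2 * real k * (2 * real k + 1))"
  have "1 * 1 \<le> 2 * real k * (2 * real k + 1)" using k by (intro mult_mono) auto
  then have "?x \<le> (real n)\<^sup>2 / 1" by (intro divide_left_mono) auto
  moreover have "0 < ?x" using k n by simp
  ultimately have "ln ?x \<le> ln ((real n)\<^sup>2)" using ln_mono by fastforce
  also have "\<dots> = 2 * ln (real n)" using n by (simp add: ln_realpow)
  finally have "real k * ln ?x \<le> real k * (2 * ln (real n))" by (intro mult_left_mono) auto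
  also have "\<dots> \<le> real n / 3 * (2 * ln (real n))" using k ln by (intro mult_right_mono) auto
  finally have "real k * ln ?x \<le> 2 / 3 * (real n * ln (real n))" by simp
  moreover have "int csz \<le> \<lceil>real k * ln ?x\<rceil>"
    using csz by (simp add: T_bound_def Let_def n_def k_def)
  ultimately have "real csz < 2 / 3 * (real n * ln (real n)) + 1" by linarith
  moreover have "real n \<le> real n * ln (real n)" using ln mult_left_mono[of 1 "ln (real n)" "real n"] by simp
  ultimately show ?thesis using n of_nat_0_le_iff[of m, where 'a = real] unfolding distrib_left
    by linarith
qed


section \<open>The machine's view of an instance\<close>

locale presented_kmedian =
  fixes I :: "('u, 'w) kmedian" and C :: "'u set" and lam :: ennreal and f :: "'u \<Rightarrow> nat"
    and g :: "'w \<Rightarrow> nat" and es :: "('u \<times> 'w) list" and cs :: "'u list"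
  assumes inst: "kmedian_instance I"
    and zero_cost: "\<And>j. j \<in> customers I \<Longrightarrow> \<exists>i \<in> centers I. cost I i j = 0"
    and C: "C \<subseteq> centers I"
    and pres: "presentation I C f g es cs"
begin

sublocale input_data "num_customers I" "length es" "kpar I" "length cs" "enn2real lam"
  "array_of (map (\<lambda>(i, j). f i) es)" "array_of (map (\<lambda>(i, j). g j) es)" "array_of (map f cs)"
  "array_of (map (\<lambda>(i, j). enn2real (cost I i j)) es)" .

lemma fin: "finite (centers I)" "finite (customers I)"
  using inst by (auto simp: kmedian_instance_def)

lemma inj_f: "inj_on f (centers I)" and inj_g: "inj_on g (customers I)"
  and bij_g: "bij_betw g (customers I) {..<num_customers I}"
  using pres by (auto simp: presentation_def bij_betw_def num_customers_def)

text \<open>Edge costs are finite, so \<open>ennreal\<close> undoes \<open>enn2real\<close> and the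
  cost array loses no information.\<close>

lemma edge_at:
  assumes "e < length es"
  obtains i j where "es ! e = (i, j)" "(i, j) \<in> edges I" "i \<in> centers I" "j \<in> customers I"
    "array_of (map (\<lambda>(i, j). f i) es) e = f i" "array_of (map (\<lambda>(i, j). g j) es) e = g j"
    "ennreal (array_of (map (\<lambda>(i, j). enn2real (cost I i j)) es) e) = cost I i j"
proof -
  obtain i j where e: "es ! e = (i, j)" by fastforce
  then have "(i, j) \<in> edges I" using assms pres nth_mem[of e es] by (simp add: presentation_def)
  then have "i \<in> centers I" "j \<in> customers I" "cost I i j < \<infinity>"
    using inst by (auto simp: kmedian_instance_def)
  with that e \<open>(i, j) \<in> edges I\<close> assms show ?thesis by (simp add: array_of_def)
qed

lemma edge_index:
  assumes "(i, j) \<in> edges I"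
  obtains e where "e < length es" "es ! e = (i, j)"
  using assms pres by (metis presentation_def in_set_conv_nth)

lemma non_edge: "i \<in> centers I \<Longrightarrow> j \<in> customers I \<Longrightarrow> (i, j) \<notin> edges I \<Longrightarrow> cost I i j = \<infinity>"
  using inst by (auto simp: kmedian_instance_def)

lemma C_image: "array_of (map f cs) ` {..<length cs} = f ` C"
proof -
  have "array_of (map f cs) ` {..<length cs} = (\<lambda>a. f (cs ! a)) ` {..<length cs}"
    by (intro image_cong) (auto simp: array_of_def)
  also have "\<dots> = f ` set cs" by (auto simp: set_conv_nth)
  finally show ?thesis using pres by (simp add: presentation_def)
qed

text \<open>Pairs that are not edges cost \<infinity>, so the infimum over \<open>C\<close> depends
  only on edges out of \<open>C\<close>. There the scanned value is a lower bound
  (\<open>lower\<close>) and attained (\<open>upper\<close>); for the latter, injectivity of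
  \<open>f\<close> and \<open>g\<close> recovers center and customer from their numbers.\<close>

lemma dist_to_nearest:
  assumes near: "nearest (f ` C) (length es) has d" and j: "j \<in> customers I"
  shows "dist_to I C j = (if 0 < has (g j) then ennreal (d (g j)) else \<infinity>)"
    and "0 < has (g j) \<Longrightarrow> 0 \<le> d (g j)"
proof -
  have lower: "0 < has (g j) \<and> ennreal (d (g j)) \<le> cost I i j" if "i \<in> C" "(i, j) \<in> edges I" for i
  proof -
    from that(2) obtain e where e: "e < length es" "es ! e = (i, j)" by (rule edge_index)
    from e(1) obtain i' j' where e': "es ! e = (i', j')"
      "array_of (map (\<lambda>(i, j). f i) es) e = f i'" "array_of (map (\<lambda>(i, j). g j) es) e = g j'"
      "ennreal (array_of (map (\<lambda>(i, j). enn2real (cost I i j)) es) e) = cost I i' j'"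
      by (rule edge_at)
    with e near that show ?thesis unfolding nearest_def
      by (metis ennreal_leI imageI prod.inject)
  qed
  have upper: "\<exists>i \<in> C. ennreal (d (g j)) = cost I i j \<and> 0 \<le> d (g j)" if pos: "0 < has (g j)"
  proof -
    obtain e where e: "e < length es" "array_of (map (\<lambda>(i, j). g j) es) e = g j"
        "array_of (map (\<lambda>(i, j). f i) es) e \<in> f ` C"
        "d (g j) = array_of (map (\<lambda>(i, j). enn2real (cost I i j)) es) e"
      using near pos unfolding nearest_def by blast
    from e(1) obtain i' j' where e': "i' \<in> centers I" "j' \<in> customers I"
      "array_of (map (\<lambda>(i, j). f i) es) e = f i'" "array_of (map (\<lambda>(i, j). g j) es) e = g j'"
      "ennreal (array_of (map (\<lambda>(i, j). enn2real (cost I i j)) es) e) = cost I i' j'"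
      by (rule edge_at)
    have "j' = j" using e e' j inj_g by (auto dest: inj_onD)
    moreover have "i' \<in> C" using e e' C inj_f by (auto dest: inj_onD)
    moreover have "0 \<le> d (g j)"
      using e(1,4) by (auto simp: array_of_def split: prod.split)
    ultimately show ?thesis using e e' by auto
  qed
  then show "0 < has (g j) \<Longrightarrow> 0 \<le> d (g j)" by blast
  show "dist_to I C j = (if 0 < has (g j) then ennreal (d (g j)) else \<infinity>)"
  proof (cases "0 < has (g j)")
    case True
    obtain i where "i \<in> C" "ennreal (d (g j)) = cost I i j" using upper True by blast
    then have "dist_to I C j \<le> ennreal (d (g j))" by (auto simp: dist_to_def intro: INF_lower)
    moreover have "ennreal (d (g j)) \<le> dist_to I C j" unfolding dist_to_def
    proof (rule INF_greatest)
      fix i assume "i \<in> C"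
      then show "ennreal (d (g j)) \<le> cost I i j"
        using lower[of i] non_edge[of i j] C j by (cases "(i, j) \<in> edges I") auto
    qed
    ultimately show ?thesis using True by simp
  next
    case False
    have "cost I i j = \<infinity>" if "i \<in> C" for i
      using that lower[of i] non_edge[of i j] C j False by auto
    then have "dist_to I C j = (INF i\<in>C. \<infinity>)" by (simp add: dist_to_def)
    \<comment> \<open>For empty \<open>C\<close> the value \<infinity> comes from the infimum over
      the empty set.\<close>
    with False show ?thesis by (cases "C = {}") auto
  qed
qed

text \<open>A center of cost 0 is joined to \<open>j\<close> by an edge, as all other pairs cost
  \<infinity>; hence the scan stored some center for \<open>j\<close>. It may be a different one,
  but it also has cost 0.\<close>

lemma zero_center:
  assumes "zero_centers (length es) zc" "j \<in> customers I"
  shows "\<exists>i \<in> centers I. zc (g j) = f i \<and> cost I i j = 0"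
proof -
  obtain i where i: "i \<in> centers I" "cost I i j = 0" using zero_cost assms by blast
  then have "(i, j) \<in> edges I" using non_edge assms by force
  then obtain e where e: "e < length es" "es ! e = (i, j)" by (rule edge_index)
  then have "array_of (map (\<lambda>(i, j). g j) es) e = g j"
      "array_of (map (\<lambda>(i, j). enn2real (cost I i j)) es) e \<le> 0"
    using i by (simp_all add: array_of_def)
  with assms(1) e(1) obtain e' where e': "e' < length es"
      "array_of (map (\<lambda>(i, j). g j) es) e' = g j"
      "array_of (map (\<lambda>(i, j). enn2real (cost I i j)) es) e' \<le> 0"
      "zc (g j) = array_of (map (\<lambda>(i, j). f i) es) e'"
    unfolding zero_centers_def by metis
  from e'(1) obtain i' j' where "i' \<in> centers I" "j' \<in> customers I"
    "array_of (map (\<lambda>(i, j). f i) es) e' = f i'" "array_of (map (\<lambda>(i, j). g j) es) e' = g j'"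
    "ennreal (array_of (map (\<lambda>(i, j). enn2real (cost I i j)) es) e') = cost I i' j'"
    by (rule edge_at)
  moreover from this e' have "j' = j" using assms inj_g by (auto dest: inj_onD)
  ultimately show ?thesis using e' by (intro bexI[of _ i']) (auto simp: ennreal_neg)
qed

section \<open>Cost and size of the computed set\<close>

lemma sum_index:
  fixes h :: "nat \<Rightarrow> real"
  assumes "A \<subseteq> {..<num_customers I}"
  shows "sum h A = (\<Sum>j | j \<in> customers I \<and> g j \<in> A. h (g j))"
    and "card A = card {j \<in> customers I. g j \<in> A}"
proof -
  have "bij_betw g {j \<in> customers I. g j \<in> A} A"
    unfolding bij_betw_def
  proof
    show "inj_on g {j \<in> customers I. g j \<in> A}" by (rule inj_on_subset[OF inj_g]) auto
    have "A \<subseteq> g ` customers I" using assms bij_g by (simp add: bij_betw_def)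
    then show "g ` {j \<in> customers I. g j \<in> A} = A" by auto
  qed
  then show "sum h A = (\<Sum>j | j \<in> customers I \<and> g j \<in> A. h (g j))"
      "card A = card {j \<in> customers I. g j \<in> A}"
    by (simp_all add: sum.reindex_bij_betw bij_betw_same_card)
qed

text \<open>A customer in \<open>Q\<close> is served at cost 0 by its stored center, and any other
  is no worse off than with \<open>C\<close>. For finite \<lambda> the far customers, possibly at
  infinite distance, all lie in \<open>Q\<close>.\<close>

lemma set_cost_le:
  assumes kn: "2 * kpar I < num_customers I"
    and capped: "capped_cost I lam C < 1"
    and near: "nearest (f ` C) (length es) has d" and zc: "zero_centers (length es) zc"
    and C': "C \<subseteq> C'" "C' \<subseteq> centers I" "zc ` Q \<subseteq> f ` C'"
    and Q: "Q \<subseteq> {..<num_customers I}"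
    and chosen: "card (far has d) \<le> 2 * kpar I \<longrightarrow> far has d \<subseteq> Q \<and>
      sum d ({..<num_customers I} - Q) \<le>
      real (num_customers I - 2 * kpar I) / real (num_customers I - card (far has d)) *
        sum d ({..<num_customers I} - far has d)"
  shows "set_cost I C' \<le> lam"
proof (cases "lam = \<infinity>")
  case True
  then show ?thesis by simp
next
  case False
  define l where "l = enn2real lam"
  define F where "F = {j \<in> customers I. \<not> 0 < has (g j) \<or>
    real (num_customers I) * l < (real (num_customers I) - 2 * real (kpar I)) *
      (2 * real (kpar I) + 1) * d (g j)}"
  have l: "lam = ennreal l" "0 \<le> l" using False by (auto simp: l_def less_top)
  have g: "g j < num_customers I" if "j \<in> customers I" for j
    using that bij_g by (auto simp: bij_betw_def)
  \<comment> \<open>Truncated and real subtraction agree here because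
    \<open>2 * k < n\<close>.\<close>
  have F_far: "F = {j \<in> customers I. g j \<in> far has d}"
    using g kn by (auto simp: F_def far_def l_def of_nat_diff add.commute)
  have near_F: "customers I - F = {j \<in> customers I. g j \<in> {..<num_customers I} - far has d}"
    using g by (auto simp: F_far)
  have far_sub: "far has d \<subseteq> {..<num_customers I}" by (rule far_subset)
  have card_F: "card F = card (far has d)"
    unfolding F_far using sum_index(2)[OF far_sub] by simp
  have sum_F: "(\<Sum>j\<in>customers I - F. d (g j)) = sum d ({..<num_customers I} - far has d)"
    unfolding near_F by (subst sum_index(1)) auto
  have bounds: "card F \<le> 2 * kpar I"
    "(real (num_customers I) - 2 * real (kpar I)) * (\<Sum>j\<in>customers I - F. d (g j)) \<le>
      real (num_customers I) * l * (1 - real (card F) / (2 * real (kpar I) + 1))"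
    unfolding F_def
    by (rule capped_cost_bounds[where C = C];
        use fin kn l capped dist_to_nearest[OF near] in simp)+
  have "real (num_customers I - 2 * kpar I) / real (num_customers I - card F) *
      (\<Sum>j\<in>customers I - F. d (g j)) \<le> l"
    using discount_le[OF l(2) _ _ _ _ bounds(2)] bounds(1) kn by (simp add: of_nat_diff)
  then have rest: "sum d ({..<num_customers I} - Q) \<le> l" and far_Q: "far has d \<subseteq> Q"
    using chosen bounds(1) by (auto simp: card_F sum_F)
  have "dist_to I C' j \<le> (if g j \<in> Q then 0 else ennreal (d (g j)))" if j: "j \<in> customers I" for j
  proof (cases "g j \<in> Q")
    case True
    obtain i where i: "i \<in> centers I" "zc (g j) = f i" "cost I i j = 0"
      using zero_center[OF zc j] by blast
    have "zc (g j) \<in> f ` C'" using C'(3) True by blast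
    then have "f i \<in> f ` C'" using i(2) by simp
    then have "i \<in> C'" using C'(2) i(1) inj_f by (auto dest: inj_onD)
    then have "dist_to I C' j \<le> cost I i j" unfolding dist_to_def by (rule INF_lower)
    then show ?thesis using True i by simp
  next
    case False
    then have "0 < has (g j)" using far_Q g[OF j] by (auto simp: far_def)
    moreover have "dist_to I C' j \<le> dist_to I C j"
      unfolding dist_to_def using C'(1) by (rule INF_superset_mono) simp
    ultimately show ?thesis using False dist_to_nearest(1)[OF near j] by simp
  qed
  then have "set_cost I C' \<le> (\<Sum>j\<in>customers I. if g j \<in> Q then 0 else ennreal (d (g j)))"
    unfolding set_cost_def by (rule sum_mono)
  also have "\<dots> = (\<Sum>j | j \<in> customers I \<and> g j \<in> {..<num_customers I} - Q. ennreal (d (g j)))"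
    using fin g by (intro sum.mono_neutral_cong_right) auto
  also have "\<dots> = ennreal (\<Sum>j | j \<in> customers I \<and> g j \<in> {..<num_customers I} - Q. d (g j))"
  proof (rule sum_ennreal)
    fix j assume "j \<in> {j \<in> customers I. g j \<in> {..<num_customers I} - Q}"
    then show "0 \<le> d (g j)" using far_Q dist_to_nearest(2)[OF near, of j] by (auto simp: far_def)
  qed
  also have "\<dots> = ennreal (sum d ({..<num_customers I} - Q))"
    by (subst sum_index(1)) auto
  also have "\<dots> \<le> lam" using rest l by (simp add: ennreal_leI)
  finally show ?thesis .
qed

lemma augment_correct:
  assumes kn: "2 * kpar I < num_customers I" and capped: "capped_cost I lam C < 1"
  shows "\<exists>C' t s'. exec augment (input_state I lam f g es cs) t s' \<and> outputs s' f C' \<and>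
    C' \<subseteq> centers I \<and> card C' \<le> card C + 2 * kpar I \<and> set_cost I C' \<le> lam \<and>
    t \<le> 11 + 8 * card C + 11 * num_edges I + 29 * num_customers I"
proof -
  let ?s = "input_state I lam f g es cs"
  have sizes: "length cs = card C" "length es = num_edges I"
    using pres distinct_card by (force simp: presentation_def num_edges_def)+
  have "reads ?s" by (simp add: reads_def input_state_def)
  moreover have "narr ?s ''has'' = (\<lambda>_. 0)" "listed ?s {}"
    by (simp_all add: input_state_def listed_def)
  ultimately obtain t s' has zc d Q where run: "exec augment ?s t s'"
      "t \<le> 11 + 8 * length cs + 11 * length es + 29 * num_customers I"
    and near: "nearest (f ` C) (length es) has d" and zc: "zero_centers (length es) zc"
    and out: "listed s' (f ` C \<union> zc ` Q)"
    and Q: "Q \<subseteq> {..<num_customers I}" "card Q \<le> 2 * kpar I"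
    and chosen: "card (far has d) \<le> 2 * kpar I \<longrightarrow> far has d \<subseteq> Q \<and>
      sum d ({..<num_customers I} - Q) \<le>
      real (num_customers I - 2 * kpar I) / real (num_customers I - card (far has d)) *
        sum d ({..<num_customers I} - far has d)"
    using exec_augment[of ?s] kn unfolding C_image by blast
  \<comment> \<open>\<open>C'\<close> is read back from the output numbers. Its image under
    \<open>f\<close> is the whole output because the number stored for a customer always belongs to
    a center.\<close>
  define C' where "C' = {i \<in> centers I. f i \<in> f ` C \<union> zc ` Q}"
  have "zc ` Q \<subseteq> f ` centers I"
  proof
    fix x assume "x \<in> zc ` Q"
    then obtain a where "a \<in> Q" "x = zc a" by blast
    moreover from this Q bij_g obtain j where "j \<in> customers I" "a = g j"
      by (auto simp: bij_betw_def)
    ultimately show "x \<in> f ` centers I" using zero_center[OF zc] by blast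
  qed
  moreover have "f ` C' = f ` centers I \<inter> (f ` C \<union> zc ` Q)" by (auto simp: C'_def)
  ultimately have fC': "f ` C' = f ` C \<union> zc ` Q" using C by auto
  have C': "C \<subseteq> C'" "C' \<subseteq> centers I" using C by (auto simp: C'_def)
  have "card C' = card (f ` C \<union> zc ` Q)"
    unfolding fC'[symmetric] using card_image[OF inj_on_subset[OF inj_f C'(2)]] by simp
  also have "\<dots> \<le> card (f ` C) + card (zc ` Q)" by (rule card_Un_le)
  also have "\<dots> \<le> card C + card Q"
    using C fin Q(1) by (intro add_mono card_image_le) (auto intro: finite_subset)
  finally have "card C' \<le> card C + 2 * kpar I" using Q by linarith
  moreover have "set_cost I C' \<le> lam"
    using kn capped near zc C' _ Q(1) chosen by (rule set_cost_le) (simp add: fC')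
  moreover have "outputs s' f C'"
    using out by (simp add: outputs_def Let_def fC' listed_def distinct_map lessThan_atLeast0)
  ultimately show ?thesis using run C'(2) unfolding sizes by blast
qed

end


theorem theorem2:
  "\<exists>(P :: com) (K :: real). 0 < K \<and>
    (\<forall>(I :: ('u, 'w) kmedian) C lam f g es cs.
      kmedian_instance I \<longrightarrow>
      2 \<le> kpar I \<longrightarrow>
      real (kpar I) \<le> real (num_customers I) / 3 \<longrightarrow>
      (\<forall>j \<in> customers I. \<exists>i \<in> centers I. cost I i j = 0) \<longrightarrow>
      C \<subseteq> centers I \<longrightarrow>
      int (card C) \<le> T_bound I \<longrightarrow>
      capped_cost I lam C < 1 \<longrightarrow>
      presentation I C f g es cs \<longrightarrow>
      (\<exists>C' t s'.
        exec P (input_state I lam f g es cs) t s' \<and>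
        outputs s' f C' \<and>
        C' \<subseteq> centers I \<and>
        int (card C') \<le> T_bound I + 2 * int (kpar I) \<and>
        set_cost I C' \<le> lam \<and>
        real t \<le> K * (real (num_edges I) +
          real (num_customers I) * ln (real (num_customers I)))))"
\<comment> \<open>Program and constant are fixed before the instance; 40 is the constant of
  \<open>steps_le\<close>.\<close>
proof (rule exI[of _ augment], rule exI[of _ 40], intro conjI allI impI)
  show "(0 :: real) < 40" by simp
next
  fix I :: "('u, 'w) kmedian" and C lam f g es cs
  assume inst: "kmedian_instance I" and k: "2 \<le> kpar I"
      "real (kpar I) \<le> real (num_customers I) / 3"
    and zero: "\<forall>j \<in> customers I. \<exists>i \<in> centers I. cost I i j = 0"
    and C: "C \<subseteq> centers I" and T: "int (card C) \<le> T_bound I"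
    and capped: "capped_cost I lam C < 1" and pres: "presentation I C f g es cs"
  interpret presented_kmedian I C lam f g es cs
    using inst zero C pres by unfold_locales auto
  have "2 * kpar I < num_customers I" using k by linarith
  from augment_correct[OF this capped] obtain C' t s'
    where "exec augment (input_state I lam f g es cs) t s'" "outputs s' f C'" "C' \<subseteq> centers I"
      "set_cost I C' \<le> lam"
      and card: "card C' \<le> card C + 2 * kpar I"
      and t: "t \<le> 11 + 8 * card C + 11 * num_edges I + 29 * num_customers I"
    by blast
  moreover have "int (card C') \<le> T_bound I + 2 * int (kpar I)" using card T by linarith
  moreover have "real t \<le> 11 + 8 * real (card C) + 11 * real (num_edges I) +
      29 * real (num_customers I)"
    using t by linarith
  then have "real t \<le> 40 * (real (num_edges I) +
      real (num_customers I) * ln (real (num_customers I)))"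
    using steps_le[OF k T, of "num_edges I"] by linarith
  ultimately show "\<exists>C' t s'. exec augment (input_state I lam f g es cs) t s' \<and>
      outputs s' f C' \<and> C' \<subseteq> centers I \<and> int (card C') \<le> T_bound I + 2 * int (kpar I) \<and>
      set_cost I C' \<le> lam \<and> real t \<le> 40 * (real (num_edges I) +
        real (num_customers I) * ln (real (num_customers I)))"
    by blast
qed

end
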